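(* As formal power series in $q$, \[ (q;q^3)_\infty \sum_{m,n\geq 0} \frac{(-1)^n q^{\frac{3n(3n+1)}{2} + m^2+ 3mn +m +3n+1}}{(q;q)_m(q^3;q^3)_n} = \cfrac{q}{1+ q - \cfrac{ q^{3}}{1+ q^{2} - \cfrac{ q^{5}}{1+q^3 - \cfrac{q^7}{\ddots}}}}, \] where the right-hand side is the $q$-adic limit, as $M\to\infty$, of the finite continued fractions $q/C^{(M)}_1$ defined by $C^{(M)}_M=1+q^M$ and $C^{(M)}_r=1+q^r-q^{2r+1}/C^{(M)}_{r+1}$ for $1\le r<M$.
   Context: $(A;q)_n=\prod_{j=0}^{n-1}(1-Aq^j)$, $(A;q)_\infty=\prod_{j\ge0}(1-Aq^j)$. *)

theory Defs
  imports "HOL-Analysis.Analysis" "HOL-Computational_Algebra.Formal_Power_Series"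
begin

definition qpoch :: "'a::comm_ring_1 \<Rightarrow> 'a \<Rightarrow> nat \<Rightarrow> 'a" where
  "qpoch A q n = (\<Prod>j<n. 1 - A * q ^ j)"

definition qpoch_inf :: "'a::{comm_ring_1,t2_space} \<Rightarrow> 'a \<Rightarrow> 'a" where
  "qpoch_inf A q = (\<Prod>j. 1 - A * q ^ j)"

definition double_sum_term :: "rat fps \<Rightarrow> nat \<Rightarrow> nat \<Rightarrow> rat fps" where
  "double_sum_term q m n =
     (-1) ^ n * q ^ (3 * n * (3 * n + 1) div 2 + m ^ 2 + 3 * m * n + m + 3 * n + 1)
       / (qpoch q q m * qpoch (q ^ 3) (q ^ 3) n)"

(* cf_denom M r is C^(M)_r for 1 <= r <= M; the value for r > M is irrelevant.
   The recursion goes downwards from r = M. *)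
function cf_denom :: "nat \<Rightarrow> nat \<Rightarrow> rat fps" where
  "cf_denom M r =
     (if r < M then 1 + fps_X ^ r - fps_X ^ (2 * r + 1) / cf_denom M (Suc r)
      else 1 + fps_X ^ M)"
  by auto
termination
  by (relation "Wellfounded.measure (\<lambda>(M, r). M - r)") auto

declare cf_denom.simps [simp del]

lemma cf_denom_last: "cf_denom M M = 1 + fps_X ^ M"
  by (subst cf_denom.simps) simp

lemma cf_denom_step:
  "r < M \<Longrightarrow> cf_denom M r = 1 + fps_X ^ r - fps_X ^ (2 * r + 1) / cf_denom M (Suc r)"
  by (subst cf_denom.simps) simp

(* All divisions by cf_denom are divisions by units of the power series ring. *)
lemma cf_denom_nth_0:
  assumes "1 \<le> r" "r \<le> M"
  shows "fps_nth (cf_denom M r) 0 = 1"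
  using assms(2,1)
proof (induction r rule: inc_induct)
  case base
  then show ?case by (simp add: cf_denom_last)
next
  case (step n)
  then have "fps_nth (cf_denom M (Suc n)) 0 = 1" by simp
  then show ?case using step
    by (simp add: cf_denom_step fps_divide_unit)
qed

end

theory Submission
  imports Defs
begin

text \<open>
  With $k = m + 3n$ the double sum equals $q\,F(q^2)$, where $F(x) = \sum_k b_k q^{k(k-1)/2} x^k$ and
  $\sum_k b_k z^k = \prod_{j\ge 0} (1 + zq^j) / (1 + z^3q^{3j}) = \prod_{j\ge 0} 1 / (1 - zq^j + z^2q^{2j})$.
  The functional equation of this product yields $F(x) = (1+x) F(xq) - q x^2 F(xq^2)$, so the continued
  fraction is $q F(q^2) / F(q)$, and it remains to see that $F(q) = 1 / (q;q^3)_\infty$.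

  Factoring $1 - z + z^2$ over the primitive sixth roots of unity turns $F$ into a ${}_1\phi_1$ series,
  whose standard transformation reads
  $F(x) = \sum_k (-1)^k q^{3k(k-1)/2} x^{2k} / (q;q)_k \cdot \prod_{j \ge k} (1 + xq^j + x^2q^{2j})$.
  For $x = q^r$ the products are quotients of $(q^3;q^3)$ and $(q;q)$ factorials. Rather than
  adjoining roots of unity, we check that the right-hand side obeys the same recurrence in $r$ and
  has the same limit. At $x = q$ the factors $(q;q)_k$ cancel, and the series is Euler's expansion of
  $(q^2;q^3)_\infty$ in base $q^3$, times $(q^3;q^3)_\infty / (q;q)_\infty$.
\<close>

unbundle no vec_syntax and fps_syntax

subsection \<open>Infinite sums of formal power series\<close>

text \<open>Convergence means that every coefficient is eventually constant, and coefficient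
  \<open>n\<close> of a sum depends only on coefficient \<open>n\<close> of the summands. This and
  the next instances open up the generic limit and \<open>has_sum\<close> rules.\<close>

instance fps :: (group_add) topological_monoid_add
proof
  fix a b :: "'a fps"
  show "LIM x (nhds a \<times>\<^sub>F nhds b). fst x + snd x :> nhds (a + b)"
  proof (rule tendsto_fpsI)
    fix n
    have "\<forall>\<^sub>F x in nhds a \<times>\<^sub>F nhds b. fst x $ n = a $ n"
      using filterlim_fst[of "nhds a" "nhds b"] unfolding tendsto_fps_iff by blast
    moreover have "\<forall>\<^sub>F x in nhds a \<times>\<^sub>F nhds b. snd x $ n = b $ n"
      using filterlim_snd[of "nhds b" "nhds a"] unfolding tendsto_fps_iff by blast
    ultimately show "\<forall>\<^sub>F x in nhds a \<times>\<^sub>F nhds b. (fst x + snd x) $ n = (a + b) $ n"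
      by eventually_elim simp
  qed
qed

instance fps :: (group_add) topological_group_add
proof
  fix a :: "'a fps"
  have "((\<lambda>x. x) \<longlongrightarrow> a) (nhds a)"
    by (rule filterlim_ident)
  then show "(uminus \<longlongrightarrow> - a) (nhds a)"
    unfolding tendsto_fps_iff by (auto elim!: eventually_mono)
qed

instance fps :: (ab_group_add) topological_ab_group_add ..

instance fps :: (ring) topological_semigroup_mult
proof
  fix a b :: "'a fps"
  show "LIM x (nhds a \<times>\<^sub>F nhds b). fst x * snd x :> nhds (a * b)"
  proof (rule tendsto_fpsI)
    \<comment> \<open>Coefficient \<open>n\<close> of a product involves only the coefficients up to
      \<open>n\<close> of the factors: finitely many conditions that hold eventually.\<close>
    fix n
    have "\<forall>\<^sub>F x in nhds a \<times>\<^sub>F nhds b. \<forall>i\<in>{..n}. fst x $ i = a $ i"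
      using filterlim_fst[of "nhds a" "nhds b"] unfolding tendsto_fps_iff
      by (subst eventually_ball_finite_distrib) auto
    moreover have "\<forall>\<^sub>F x in nhds a \<times>\<^sub>F nhds b. \<forall>i\<in>{..n}. snd x $ i = b $ i"
      using filterlim_snd[of "nhds b" "nhds a"] unfolding tendsto_fps_iff
      by (subst eventually_ball_finite_distrib) auto
    ultimately show "\<forall>\<^sub>F x in nhds a \<times>\<^sub>F nhds b. (fst x * snd x) $ n = (a * b) $ n"
      by eventually_elim (simp add: fps_mult_nth)
  qed
qed

text \<open>All sufficiently large finite partial sums share coefficient \<open>n\<close> with
  \<open>S\<close>, and their index set may be enlarged to contain \<open>B\<close>. Serves to read
  leading coefficients off infinite sums.\<close>

lemma has_sum_fps_nth_eq:
  fixes f :: "'i \<Rightarrow> 'a::ab_group_add fps"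
  assumes "(f has_sum S) A" "finite B" "B \<subseteq> A" "\<And>i. i \<in> A - B \<Longrightarrow> f i $ n = 0"
  shows "S $ n = (\<Sum>i\<in>B. f i $ n)"
proof -
  have "\<forall>\<^sub>F X in finite_subsets_at_top A. sum f X $ n = S $ n"
    using assms(1) unfolding has_sum_def tendsto_fps_iff by blast
  then obtain Y where Y: "finite Y" "Y \<subseteq> A"
    "\<And>X. finite X \<Longrightarrow> Y \<subseteq> X \<Longrightarrow> X \<subseteq> A \<Longrightarrow> sum f X $ n = S $ n"
    unfolding eventually_finite_subsets_at_top by metis
  define X where "X = B \<union> Y"
  have X: "sum f X $ n = S $ n" "finite X" "B \<subseteq> X" "X \<subseteq> A"
    using Y assms(2,3) unfolding X_def by auto
  have "S $ n = (\<Sum>i\<in>X. f i $ n)"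
    using X(1) by (simp add: fps_sum_nth)
  also have "\<dots> = (\<Sum>i\<in>B. f i $ n)"
    using X assms(4) by (intro sum.mono_neutral_right) auto
  finally show ?thesis .
qed

text \<open>Partial sums are constant in coefficient \<open>n\<close> once their index set contains
  the finitely many terms that reach it.\<close>

lemma summable_on_fpsI:
  fixes f :: "'i \<Rightarrow> 'a::ab_group_add fps"
  assumes "\<And>n. finite {i \<in> A. f i $ n \<noteq> 0}"
  shows "f summable_on A"
proof -
  define S where "S = Abs_fps (\<lambda>n. \<Sum>i\<in>{i \<in> A. f i $ n \<noteq> 0}. f i $ n)"
  have "(f has_sum S) A"
    unfolding has_sum_def
  proof (rule tendsto_fpsI)
    fix n
    let ?B = "{i \<in> A. f i $ n \<noteq> 0}"
    have "sum f X $ n = S $ n" if "finite X" "?B \<subseteq> X" "X \<subseteq> A" for X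
    proof -
      have "sum f X $ n = (\<Sum>i\<in>X. f i $ n)"
        by (simp add: fps_sum_nth)
      also have "\<dots> = (\<Sum>i\<in>?B. f i $ n)"
        using that by (intro sum.mono_neutral_right) auto
      finally show ?thesis by (simp add: S_def)
    qed
    then show "\<forall>\<^sub>F X in finite_subsets_at_top A. sum f X $ n = S $ n"
      unfolding eventually_finite_subsets_at_top using assms[of n]
      by (intro exI[of _ ?B]) auto
  qed
  then show ?thesis by (auto simp: summable_on_def)
qed

lemma has_sum_diff:
  fixes f g :: "'a \<Rightarrow> 'b::topological_ab_group_add"
  assumes "(f has_sum a) A" "(g has_sum b) A"
  shows "((\<lambda>x. f x - g x) has_sum (a - b)) A"
  using has_sum_add[OF assms(1), of "\<lambda>x. - g x" "- b"] assms(2) by (simp add: has_sum_uminus)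

text \<open>Index shift: lets term \<open>Suc k\<close> of one series be compared with term
  \<open>k\<close> of another.\<close>

lemma has_sum_Suc_iff:
  fixes f :: "nat \<Rightarrow> 'a::{comm_monoid_add,topological_space}"
  assumes "f 0 = 0"
  shows "((\<lambda>k. f (Suc k)) has_sum S) UNIV \<longleftrightarrow> (f has_sum S) UNIV"
proof -
  have neutral: "f x = 0" if "x \<notin> range Suc" for x
    using that assms by (cases x) auto
  have "((\<lambda>k. f (Suc k)) has_sum S) UNIV \<longleftrightarrow> (f has_sum S) (range Suc)"
    by (subst has_sum_reindex) (auto simp: o_def)
  also have "\<dots> \<longleftrightarrow> (f has_sum S) UNIV"
    using neutral by (intro has_sum_cong_neutral) auto
  finally show ?thesis .
qed

text \<open>Finite fibres make the sets \<open>Sigma K B\<close> with \<open>K\<close> finite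
  cofinal among the finite subsets of \<open>Sigma A B\<close>, so the grouped sums run along a
  subnet of the partial sums.\<close>

lemma has_sum_finite_fibres:
  assumes "(f has_sum S) (Sigma A B)" "\<And>k. k \<in> A \<Longrightarrow> finite (B k)"
  shows "((\<lambda>k. \<Sum>x\<in>B k. f (k, x)) has_sum S) A"
proof -
  have "filterlim (\<lambda>K. Sigma K B) (finite_subsets_at_top (Sigma A B)) (finite_subsets_at_top A)"
    unfolding filterlim_iff
  proof (intro allI impI)
    fix P :: "('a \<times> 'b) set \<Rightarrow> bool"
    assume "\<forall>\<^sub>F X in finite_subsets_at_top (Sigma A B). P X"
    then obtain X where X: "finite X" "X \<subseteq> Sigma A B"
      "\<And>Y. finite Y \<Longrightarrow> X \<subseteq> Y \<Longrightarrow> Y \<subseteq> Sigma A B \<Longrightarrow> P Y"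
      unfolding eventually_finite_subsets_at_top by metis
    have "P (Sigma K B)" if "finite K" "fst ` X \<subseteq> K" "K \<subseteq> A" for K
      using that assms(2) X(2) by (intro X(3) finite_SigmaI) force+
    then show "\<forall>\<^sub>F K in finite_subsets_at_top A. P (Sigma K B)"
      unfolding eventually_finite_subsets_at_top using X(1,2)
      by (intro exI[of _ "fst ` X"]) auto
  qed
  then have "((\<lambda>K. sum f (Sigma K B)) \<longlongrightarrow> S) (finite_subsets_at_top A)"
    using assms(1) unfolding has_sum_def by (rule filterlim_compose[rotated])
  moreover have "sum f (Sigma K B) = (\<Sum>k\<in>K. \<Sum>x\<in>B k. f (k, x))"
    if "finite K" "K \<subseteq> A" for K
    using that assms(2) by (subst sum.Sigma) auto
  then have "\<forall>\<^sub>F K in finite_subsets_at_top A.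
      sum f (Sigma K B) = (\<Sum>k\<in>K. \<Sum>x\<in>B k. f (k, x))"
    unfolding eventually_finite_subsets_at_top by (intro exI[of _ "{}"]) auto
  ultimately show ?thesis
    unfolding has_sum_def by (rule Lim_transform_eventually)
qed

lemma Suc_choose_2: "Suc k choose 2 = (k choose 2) + k"
  by (simp add: numeral_2_eq_2)

lemma fps_X_power_dvd_nth: "(fps_X :: 'a::comm_ring_1 fps) ^ N dvd f \<Longrightarrow> n < N \<Longrightarrow> f $ n = 0"
  by (auto simp: fps_X_power_mult_nth elim!: dvdE)

subsection \<open>Infinite $q$-factorials\<close>

lemma qpoch_Suc: "qpoch A q (Suc n) = qpoch A q n * (1 - A * q ^ n)"
  by (simp add: qpoch_def)

lemma qpoch_0 [simp]: "qpoch A q 0 = 1"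
  by (simp add: qpoch_def)

lemma qpoch_nth_0 [simp]:
  fixes A q :: "'a::comm_ring_1 fps"
  shows "A $ 0 = 0 \<Longrightarrow> qpoch A q n $ 0 = 1"
  by (induction n) (simp_all add: qpoch_Suc)

text \<open>Read from right to left, it puts consecutive reciprocals over a common denominator and
  turns later term comparisons into polynomial identities.\<close>

lemma inverse_qpoch_Suc:
  fixes A q :: "'a::field fps"
  assumes "A $ 0 = 0"
  shows "inverse (qpoch A q (Suc n)) * (1 - A * q ^ n) = inverse (qpoch A q n)"
proof -
  have "inverse (qpoch A q (Suc n)) * (1 - A * q ^ n) =
      inverse (qpoch A q n) * (inverse (1 - A * q ^ n) * (1 - A * q ^ n))"
    by (simp only: qpoch_Suc fps_inverse_mult mult.assoc)
  also have "inverse (1 - A * q ^ n) * (1 - A * q ^ n) = 1"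
    using assms by (intro inverse_mult_eq_1) simp
  finally show ?thesis by simp
qed

text \<open>Factor \<open>j\<close> is 1 - q^(a + bj) with a + bj > j, so coefficient
  \<open>k\<close> of the finite products is final from \<open>n = k\<close> on. The diagonal series
  \<open>L\<close> is therefore the limit.\<close>

lemma
  fixes a b :: nat
  defines "A \<equiv> fps_X ^ a :: 'a::idom fps" and "Q \<equiv> fps_X ^ b"
  assumes "a \<ge> 1" "b \<ge> 1"
  shows convergent_prod_qpoch: "convergent_prod (\<lambda>j. 1 - A * Q ^ j)"
    and qpoch_tendsto_inf: "(\<lambda>n. qpoch A Q n) \<longlonglongrightarrow> qpoch_inf A Q"
    and qpoch_inf_nth_0: "qpoch_inf A Q $ 0 = 1"
proof -
  define L where "L = Abs_fps (\<lambda>k. qpoch A Q k $ k)"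
  have AQ: "A * Q ^ n = fps_X ^ (a + b * n)" for n
    by (simp add: A_def Q_def power_add power_mult)
  have stable: "qpoch A Q n $ k = qpoch A Q k $ k" if "k \<le> n" for n k
    using that
  proof (induction n rule: dec_induct)
    case (step n)
    have "1 * n \<le> b * n"
      using assms(4) by (rule mult_le_mono1)
    then have "k < a + b * n"
      using step.hyps assms(3) by linarith
    then have "(qpoch A Q n * fps_X ^ (a + b * n)) $ k = 0"
      by (simp add: fps_X_power_mult_right_nth)
    then have "qpoch A Q (Suc n) $ k = qpoch A Q n $ k"
      by (simp add: qpoch_Suc AQ right_diff_distrib)
    with step show ?case by simp
  qed simp
  have lim: "(\<lambda>n. qpoch A Q n) \<longlonglongrightarrow> L"
  proof (rule tendsto_fpsI)
    fix k
    show "\<forall>\<^sub>F n in sequentially. qpoch A Q n $ k = L $ k"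
      using eventually_ge_at_top[of k] unfolding L_def fps_nth_Abs_fps
      by eventually_elim (rule stable)
  qed
  have "L $ 0 = 1"
    using assms(3) by (simp add: L_def)
  \<comment> \<open>\<open>convergent_prod\<close> demands a nonzero limit; the constant term
    provides it.\<close>
  then have "L \<noteq> 0"
    by auto
  moreover have "(\<lambda>n. \<Prod>j\<le>n. 1 - A * Q ^ j) \<longlonglongrightarrow> L"
    using filterlim_sequentially_Suc[THEN iffD2, OF lim]
    by (simp add: qpoch_def lessThan_Suc_atMost)
  ultimately have raw: "raw_has_prod (\<lambda>j. 1 - A * Q ^ j) 0 L"
    by (simp add: raw_has_prod_def)
  then have "(\<lambda>j. 1 - A * Q ^ j) has_prod L"
    by (simp add: has_prod_def)
  moreover from this have "qpoch_inf A Q = L"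
    unfolding qpoch_inf_def by (rule has_prod_unique[symmetric])
  ultimately show "convergent_prod (\<lambda>j. 1 - A * Q ^ j)" "(\<lambda>n. qpoch A Q n) \<longlonglongrightarrow> qpoch_inf A Q"
    "qpoch_inf A Q $ 0 = 1"
    using lim raw \<open>L $ 0 = 1\<close> by (auto simp: convergent_prod_def)
qed

text \<open>Euler's expansion. \<open>V n\<close> is the series at z = A Q^n; like the product it
  satisfies V(z) = (1 - z) V(zQ), and iteration reduces the claim to \<open>V n\<close> tending to
  1.\<close>

lemma has_sum_qpoch_inf:
  fixes a b :: nat
  defines "A \<equiv> fps_X ^ a :: rat fps" and "Q \<equiv> fps_X ^ b"
  assumes "a \<ge> 1" "b \<ge> 1"
  shows "((\<lambda>k. (- 1) ^ k * A ^ k * Q ^ (k choose 2) * inverse (qpoch Q Q k)) has_sum qpoch_inf A Q) UNIV"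
proof -
  have Q0: "Q $ 0 = 0"
    using assms(4) by (simp add: Q_def)
  define f where "f n k = (- 1) ^ k * (A * Q ^ n) ^ k * Q ^ (k choose 2) * inverse (qpoch Q Q k)" for n k
  define V where "V n = (\<Sum>\<^sub>\<infinity>k. f n k)" for n
  have AQ: "(A * Q ^ n) ^ k = fps_X ^ ((a + b * n) * k)" for n k
    by (simp only: A_def Q_def power_add power_mult)
  have nth0: "f n k $ i = 0" if "i < (a + b * n) * k" for n k i
    unfolding f_def AQ using that
    by (simp add: fps_X_power_mult_nth mult.assoc mult.left_commute[of "(- 1) ^ k"])
  have V: "(f n has_sum V n) UNIV" for n
    unfolding V_def
  proof (intro has_sum_infsum summable_on_fpsI)
    fix i
    have "k \<le> i" if "f n k $ i \<noteq> 0" for k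
    proof -
      have "1 * k \<le> (a + b * n) * k"
        using assms(3) by (intro mult_le_mono1) simp
      also have "\<dots> \<le> i"
        using that nth0 by (meson not_le)
      finally show ?thesis by simp
    qed
    then have "{k \<in> UNIV. f n k $ i \<noteq> 0} \<subseteq> {..i}"
      unfolding subset_iff mem_Collect_eq atMost_iff by blast
    then show "finite {k \<in> UNIV. f n k $ i \<noteq> 0}"
      by (rule finite_subset) simp
  qed
  have V_Suc: "V n = (1 - A * Q ^ n) * V (Suc n)" for n
  proof -
    \<comment> \<open>The difference carries a factor 1 - Q^(k+1), which cancels the last factor of
      \<open>qpoch Q Q (Suc k)\<close>.\<close>
    have "f n (Suc k) - f (Suc n) (Suc k) = - (A * Q ^ n) * f (Suc n) k" for k
    proof -
      define i where "i = inverse (qpoch Q Q (Suc k))"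
      have i: "inverse (qpoch Q Q k) = i * (1 - Q * Q ^ k)"
        unfolding i_def by (rule inverse_qpoch_Suc[symmetric]) (rule Q0)
      define z where "z = A * Q ^ n"
      have z: "A * Q ^ Suc n = z * Q"
        by (simp add: z_def)
      have "f n (Suc k) - f (Suc n) (Suc k) =
          - ((- 1) ^ k * z ^ Suc k * (Q ^ k * Q ^ (k choose 2)) * (i * (1 - Q * Q ^ k)))"
        unfolding f_def z z_def[symmetric] i_def[symmetric] Suc_choose_2 power_add
        by (simp add: power_mult_distrib right_diff_distrib mult_ac)
      also have "\<dots> = - z * f (Suc n) k"
        unfolding f_def z i by (simp add: power_mult_distrib mult_ac)
      finally show ?thesis
        unfolding z_def .
    qed
    moreover have "((\<lambda>k. - (A * Q ^ n) * f (Suc n) k) has_sum - (A * Q ^ n) * V (Suc n)) UNIV"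
      by (intro has_sum_cmult_right V)
    ultimately have "((\<lambda>k. f n (Suc k) - f (Suc n) (Suc k)) has_sum - (A * Q ^ n) * V (Suc n)) UNIV"
      by simp
    then have "((\<lambda>k. f n k - f (Suc n) k) has_sum - (A * Q ^ n) * V (Suc n)) UNIV"
      by (subst (asm) has_sum_Suc_iff) (simp_all add: f_def)
    moreover have "((\<lambda>k. f n k - f (Suc n) k) has_sum V n - V (Suc n)) UNIV"
      by (intro has_sum_diff V)
    ultimately have "V n - V (Suc n) = - (A * Q ^ n) * V (Suc n)"
      by (rule has_sum_unique[rotated])
    then show ?thesis by (simp add: algebra_simps)
  qed
  have V0: "V 0 = qpoch A Q n * V n" for n
  proof (induction n)
    case (Suc n)
    then show ?case by (simp add: V_Suc[of n] qpoch_Suc mult.assoc)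
  qed simp
  \<comment> \<open>For \<open>n\<close> at least \<open>i\<close>, only the term
    \<open>k = 0\<close>, which is 1, reaches coefficient \<open>i\<close>.\<close>
  have "V \<longlonglongrightarrow> 1"
  proof (rule tendsto_fpsI)
    fix i
    show "\<forall>\<^sub>F n in sequentially. V n $ i = 1 $ i"
      using eventually_ge_at_top[of i]
    proof eventually_elim
      case (elim n)
      have "1 * n \<le> b * n"
        using assms(4) by (rule mult_le_mono1)
      with elim assms(3) have "i < a + b * n"
        by linarith
      then have less: "i < (a + b * n) * 1"
        by simp
      have "V n $ i = (\<Sum>k\<in>{0}. f n k $ i)"
      proof (rule has_sum_fps_nth_eq[OF V])
        fix k assume "k \<in> UNIV - {0::nat}"
        then have "(a + b * n) * 1 \<le> (a + b * n) * k"
          by (intro mult_le_mono2) auto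
        with less show "f n k $ i = 0"
          by (intro nth0) (rule order.strict_trans2)
      qed auto
      then show ?case
        by (simp add: f_def numeral_2_eq_2)
    qed
  qed
  then have "(\<lambda>n. qpoch A Q n * V n) \<longlonglongrightarrow> qpoch_inf A Q * 1"
    unfolding A_def Q_def by (intro tendsto_mult qpoch_tendsto_inf assms(3,4))
  then have "(\<lambda>n. V 0) \<longlonglongrightarrow> qpoch_inf A Q"
    by (simp flip: V0)
  then have "V 0 = qpoch_inf A Q"
    by (simp add: LIMSEQ_const_iff)
  moreover have "f 0 = (\<lambda>k. (- 1) ^ k * A ^ k * Q ^ (k choose 2) * inverse (qpoch Q Q k))"
    by (rule ext) (simp add: f_def)
  ultimately show ?thesis
    using V[of 0] by simp
qed

subsection \<open>The three-term recurrence of the double sum\<close>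

abbreviation X :: "rat fps" where "X \<equiv> fps_X"

text \<open>
  The outer variable of \<open>rat fps fps\<close> is $z$. By Euler, \<open>exp_gf\<close> is $\prod_j (1 + zq^j)$ and
  \<open>cub_gf\<close> is $\prod_j 1 / (1 + z^3q^{3j})$; only their functional equations are needed.
\<close>

definition exp_gf :: "rat fps fps" where
  "exp_gf = Abs_fps (\<lambda>m. X ^ (m choose 2) * inverse (qpoch X X m))"

definition cub_gf :: "rat fps fps" where
  "cub_gf = Abs_fps (\<lambda>k. if 3 dvd k then (- 1) ^ (k div 3) * inverse (qpoch (X ^ 3) (X ^ 3) (k div 3)) else 0)"

definition gf_coeff :: "nat \<Rightarrow> rat fps" where
  "gf_coeff k = (exp_gf * cub_gf) $ k"

text \<open>The substitution z -> zq, written as a composition so that multiplicativity is inherited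
  from \<open>fps_compose_mult_distrib\<close>.\<close>

definition dilate :: "rat fps fps \<Rightarrow> rat fps fps" where
  "dilate f = f oo (fps_const X * fps_X)"

lemma dilate_nth [simp]: "dilate f $ n = X ^ n * f $ n"
  unfolding dilate_def by (rule fps_nth_compose_linear)

lemma dilate_mult: "dilate (f * g) = dilate f * dilate g"
  unfolding dilate_def by (rule fps_compose_mult_distrib) simp

text \<open>Splits off the factor j = 0 of the product. On coefficients e_m this reads e_(m+1) =
  q^(m+1) e_(m+1) + q^m e_m.\<close>

lemma exp_gf_dilate: "exp_gf = (1 + fps_X) * dilate exp_gf"
proof (rule fps_ext)
  fix n
  show "exp_gf $ n = ((1 + fps_X) * dilate exp_gf) $ n"
  proof (cases n)
    case (Suc m)
    define i where "i = inverse (qpoch X X (Suc m))"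
    have i: "inverse (qpoch X X m) = i * (1 - X * X ^ m)"
      unfolding i_def by (rule inverse_qpoch_Suc[symmetric]) simp
    show ?thesis
      by (simp add: Suc exp_gf_def i distrib_right Suc_choose_2 power_add flip: i_def)
        (simp add: algebra_simps)
  qed (simp add: exp_gf_def distrib_right)
qed

lemma cub_gf_mult_3: "cub_gf $ (3 * k) = (- 1) ^ k * inverse (qpoch (X ^ 3) (X ^ 3) k)"
  by (simp add: cub_gf_def)

text \<open>The map z -> zq removes the factor 1 / (1 + z^3). Only exponents divisible by 3 carry
  content.\<close>

lemma cub_gf_dilate: "(1 + fps_X ^ 3) * cub_gf = dilate cub_gf"
proof (rule fps_ext)
  fix n
  show "((1 + fps_X ^ 3) * cub_gf) $ n = dilate cub_gf $ n"
  proof (cases "3 dvd n")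
    case True
    then obtain m where n: "n = 3 * m" by (elim dvdE)
    show ?thesis
    proof (cases m)
      case (Suc k)
      define i where "i = inverse (qpoch (X ^ 3) (X ^ 3) (Suc k))"
      have i: "inverse (qpoch (X ^ 3) (X ^ 3) k) = i * (1 - X ^ 3 * (X ^ 3) ^ k)"
        unfolding i_def
        by (rule inverse_qpoch_Suc[symmetric]) simp
      have "((1 + fps_X ^ 3) * cub_gf) $ n = cub_gf $ (3 * Suc k) + cub_gf $ (3 * k)"
        by (simp add: n Suc distrib_right fps_X_power_mult_nth)
      also have "\<dots> = (- 1) ^ Suc k * i + (- 1) ^ k * (i * (1 - X ^ 3 * (X ^ 3) ^ k))"
        unfolding cub_gf_mult_3 i i_def[symmetric] by simp
      also have "\<dots> = X ^ n * ((- 1) ^ Suc k * i)"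
        unfolding n Suc power_mult power_Suc by (simp add: algebra_simps)
      also have "\<dots> = dilate cub_gf $ n"
        unfolding n Suc dilate_nth cub_gf_mult_3 i_def ..
      finally show ?thesis .
    qed (simp add: n distrib_right fps_X_power_mult_nth)
  next
    case False
    then have "\<not> 3 dvd n - 3" if "n \<ge> 3"
      using that by (simp add: dvd_minus_self)
    with False show ?thesis
      by (simp add: cub_gf_def distrib_right fps_X_power_mult_nth)
  qed
qed

text \<open>Since 1 + z^3 = (1 + z)(1 - z + z^2), the two functional equations combine up to a
  common factor 1 + z, which cancels in a domain.\<close>

lemma gf_dilate: "(1 - fps_X + fps_X ^ 2) * (exp_gf * cub_gf) = dilate (exp_gf * cub_gf)"
proof -
  have "(1 + fps_X) * ((1 - fps_X + fps_X ^ 2) * (exp_gf * cub_gf)) = exp_gf * ((1 + fps_X ^ 3) * cub_gf)"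
    by (simp add: algebra_simps power2_eq_square power3_eq_cube)
  also have "\<dots> = exp_gf * dilate cub_gf"
    by (simp only: cub_gf_dilate)
  also have "\<dots> = (1 + fps_X) * dilate exp_gf * dilate cub_gf"
    by (subst exp_gf_dilate) (rule refl)
  also have "\<dots> = (1 + fps_X) * dilate (exp_gf * cub_gf)"
    by (simp add: dilate_mult mult.assoc)
  finally have eq: "(1 + fps_X) * ((1 - fps_X + fps_X ^ 2) * (exp_gf * cub_gf)) = (1 + fps_X) * dilate (exp_gf * cub_gf)" .
  have "(1 + fps_X :: rat fps fps) $ 0 \<noteq> 0"
    by simp
  then have "(1 + fps_X :: rat fps fps) \<noteq> 0"
    by (metis fps_zero_nth)
  with eq show ?thesis
    by (metis mult_left_cancel)
qed

lemma gf_coeff_0: "gf_coeff 0 = 1"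
  by (simp add: gf_coeff_def exp_gf_def cub_gf_def numeral_2_eq_2)

text \<open>Coefficient z^n of \<open>gf_dilate\<close> reads b_n - b_(n-1) + b_(n-2) = q^n b_n. For
  n = 1 the last term on the left is absent; the next lemma treats n >= 2.\<close>

lemma gf_coeff_1: "(1 - X) * gf_coeff 1 = gf_coeff 0"
proof -
  define B where "B = exp_gf * cub_gf"
  have "((1 - fps_X + fps_X ^ 2) * B) $ 1 = dilate B $ 1"
    unfolding B_def by (simp only: gf_dilate)
  then show ?thesis
    unfolding gf_coeff_def B_def[symmetric]
    by (simp add: left_diff_distrib distrib_right fps_X_power_mult_nth del: fps_mult_nth_1)
      (simp add: algebra_simps)
qed

lemma gf_coeff_Suc_Suc: "(1 - X ^ Suc (Suc k)) * gf_coeff (Suc (Suc k)) = gf_coeff (Suc k) - gf_coeff k"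
proof -
  define B where "B = exp_gf * cub_gf"
  have "((1 - fps_X + fps_X ^ 2) * B) $ Suc (Suc k) = dilate B $ Suc (Suc k)"
    unfolding B_def by (simp only: gf_dilate)
  then show ?thesis
    unfolding gf_coeff_def B_def[symmetric]
    by (simp add: left_diff_distrib distrib_right fps_X_power_mult_nth) (simp add: algebra_simps)
qed

text \<open>\<open>F_ser r\<close> is $F(q^r)$.\<close>

definition F_term :: "nat \<Rightarrow> nat \<Rightarrow> rat fps" where
  "F_term r k = X ^ (r * k + (k choose 2)) * gf_coeff k"

definition F_ser :: "nat \<Rightarrow> rat fps" where
  "F_ser r = (\<Sum>\<^sub>\<infinity>k. F_term r k)"

lemma F_term_nth_eq_0: "r \<ge> 1 \<Longrightarrow> n < r * k \<Longrightarrow> F_term r k $ n = 0"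
  by (simp add: F_term_def fps_X_power_mult_nth)

lemma has_sum_F_ser:
  assumes "r \<ge> 1"
  shows "(F_term r has_sum F_ser r) UNIV"
proof -
  have "finite {k \<in> UNIV. F_term r k $ n \<noteq> 0}" for n
  proof (rule finite_subset)
    show "{k \<in> UNIV. F_term r k $ n \<noteq> 0} \<subseteq> {..n}"
    proof safe
      fix k assume "F_term r k $ n \<noteq> 0"
      then have "r * k \<le> n"
        using F_term_nth_eq_0[OF assms] by (meson not_le)
      moreover have "1 * k \<le> r * k"
        using assms by (rule mult_le_mono1)
      ultimately show "k \<le> n" by linarith
    qed
  qed simp
  then show ?thesis
    unfolding F_ser_def by (intro has_sum_infsum summable_on_fpsI)
qed

text \<open>All terms with k >= 1 are divisible by q^r. This yields both the limit of
  \<open>F_ser\<close> and its unit constant terms.\<close>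

lemma F_ser_nth:
  assumes "r \<ge> 1" "n < r"
  shows "F_ser r $ n = 1 $ n"
proof -
  have "F_ser r $ n = (\<Sum>k\<in>{0}. F_term r k $ n)"
  proof (rule has_sum_fps_nth_eq[OF has_sum_F_ser[OF assms(1)]])
    fix k assume "k \<in> UNIV - {0::nat}"
    then have "r * 1 \<le> r * k"
      by (intro mult_le_mono2) auto
    with assms(2) have "n < r * k" by linarith
    with assms(1) show "F_term r k $ n = 0" by (rule F_term_nth_eq_0)
  qed auto
  then show ?thesis by (simp add: F_term_def gf_coeff_0 numeral_2_eq_2)
qed

text \<open>With x = q^r, term k+1 of F(x) - F(xq) has the factor (1 - q^(k+1)) b_(k+1) = b_k -
  b_(k-1). The two parts give x F(xq) and q x^2 F(xq^2).\<close>

lemma F_ser_rec: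
  assumes "r \<ge> 1"
  shows "F_ser r = (1 + X ^ r) * F_ser (Suc r) - X ^ (2 * r + 1) * F_ser (Suc (Suc r))"
proof -
  \<comment> \<open>The series q x^2 F(xq^2) delayed by one index; the value 0 at
    \<open>k = 0\<close> stands for b_(-1) = 0.\<close>
  define e where "e k = (if k = 0 then 0 else X ^ (2 * r + 1) * F_term (Suc (Suc r)) (k - 1))" for k
  have "((\<lambda>k. e (Suc k)) has_sum X ^ (2 * r + 1) * F_ser (Suc (Suc r))) UNIV"
    unfolding e_def by (simp, intro has_sum_cmult_right has_sum_F_ser) simp
  then have "(e has_sum X ^ (2 * r + 1) * F_ser (Suc (Suc r))) UNIV"
    by (subst (asm) has_sum_Suc_iff) (simp_all add: e_def)
  then have "((\<lambda>k. X ^ r * F_term (Suc r) k - e k) has_sum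
      (X ^ r * F_ser (Suc r) - X ^ (2 * r + 1) * F_ser (Suc (Suc r)))) UNIV"
    by (intro has_sum_diff has_sum_cmult_right has_sum_F_ser) auto
  also have "(\<lambda>k. X ^ r * F_term (Suc r) k - e k) = (\<lambda>k. F_term r (Suc k) - F_term (Suc r) (Suc k))"
  proof
    fix k
    have "F_term r (Suc k) - F_term (Suc r) (Suc k) =
        X ^ (r * Suc k + (Suc k choose 2)) * ((1 - X ^ Suc k) * gf_coeff (Suc k))"
      by (simp add: F_term_def power_add algebra_simps)
    also have "(1 - X ^ Suc k) * gf_coeff (Suc k) = gf_coeff k - (if k = 0 then 0 else gf_coeff (k - 1))"
    proof (cases k)
      case 0
      then show ?thesis using gf_coeff_1 by simp
    next
      case (Suc j)
      then show ?thesis using gf_coeff_Suc_Suc[of j] by simp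
    qed
    also have "X ^ (r * Suc k + (Suc k choose 2)) * (gf_coeff k - (if k = 0 then 0 else gf_coeff (k - 1))) =
        X ^ r * F_term (Suc r) k - e k"
    proof (cases k)
      case 0
      then show ?thesis by (simp add: F_term_def e_def numeral_2_eq_2)
    next
      case (Suc j)
      have "r * Suc (Suc j) + (Suc (Suc j) choose 2) =
          (2 * r + 1) + (Suc (Suc r) * j + (j choose 2))"
        by (simp add: Suc_choose_2)
      moreover have "r * Suc (Suc j) + (Suc (Suc j) choose 2) =
          r + (Suc r * Suc j + (Suc j choose 2))"
        by (simp add: Suc_choose_2)
      ultimately have "X ^ (r * Suc (Suc j) + (Suc (Suc j) choose 2)) =
          X ^ (2 * r + 1) * X ^ (Suc (Suc r) * j + (j choose 2))"
        "X ^ (r * Suc (Suc j) + (Suc (Suc j) choose 2)) =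
          X ^ r * X ^ (Suc r * Suc j + (Suc j choose 2))"
        by (metis power_add)+
      then show ?thesis
        unfolding F_term_def e_def Suc by (simp only: right_diff_distrib mult.assoc) simp
    qed
    finally show "X ^ r * F_term (Suc r) k - e k = F_term r (Suc k) - F_term (Suc r) (Suc k)" by simp
  qed
  finally have "((\<lambda>k. F_term r k - F_term (Suc r) k) has_sum
      (X ^ r * F_ser (Suc r) - X ^ (2 * r + 1) * F_ser (Suc (Suc r)))) UNIV"
    by (subst (asm) has_sum_Suc_iff) (simp_all add: F_term_def)
  moreover have "((\<lambda>k. F_term r k - F_term (Suc r) k) has_sum (F_ser r - F_ser (Suc r))) UNIV"
    using assms by (intro has_sum_diff has_sum_F_ser) auto
  ultimately have "F_ser r - F_ser (Suc r) = X ^ r * F_ser (Suc r) - X ^ (2 * r + 1) * F_ser (Suc (Suc r))"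
    by (rule has_sum_unique[rotated])
  then show ?thesis by (simp add: algebra_simps)
qed

section \<open>Regrouping the double sum along k = m + 3n\<close>

lemma gf_coeff_eq_sum:
  "gf_coeff (k :: nat) = (\<Sum>(m, n)\<in>{(m, n). m + 3 * n = k}. exp_gf $ m * cub_gf $ (3 * n))"
proof -
  have "gf_coeff k = (\<Sum>i = 0..k. exp_gf $ i * cub_gf $ (k - i))"
    by (simp add: gf_coeff_def fps_mult_nth)
  also have "\<dots> = (\<Sum>i\<in>{i \<in> {0..k}. 3 dvd k - i}. exp_gf $ i * cub_gf $ (k - i))"
    by (intro sum.mono_neutral_right) (auto simp: cub_gf_def)
  also have "\<dots> = (\<Sum>(m, n)\<in>{(m, n). m + 3 * n = k}. exp_gf $ m * cub_gf $ (3 * n))"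
    by (rule sum.reindex_bij_witness[of _ fst "\<lambda>i. (i, (k - i) div 3)"]) auto
  finally show ?thesis .
qed

text \<open>With k = m + 3n the exponent splits as 1 + 2k + k(k-1)/2 + m(m-1)/2. The last part
  belongs to \<open>exp_gf\<close>, and 2k means evaluation at x = q^2.\<close>

lemma double_sum_term_eq:
  "double_sum_term X m n =
     X * (X ^ (2 * (m + 3 * n) + (m + 3 * n choose 2)) * (exp_gf $ m * cub_gf $ (3 * n)))"
proof -
  have choose2: "2 * (k choose 2) + k = k * k" for k
    by (induction k) (simp_all add: Suc_choose_2 numeral_2_eq_2)
  \<comment> \<open>As 3n(3n + 1) is even, the exponents can be compared after doubling, free of
    \<open>div\<close>.\<close>
  have "2 * (3 * n * (3 * n + 1) div 2) = 3 * n * (3 * n + 1)"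
    by (rule dvd_mult_div_cancel) simp
  then have "2 * (3 * n * (3 * n + 1) div 2 + m ^ 2 + 3 * m * n + m + 3 * n + 1) =
      2 * (1 + (2 * (m + 3 * n) + (m + 3 * n choose 2)) + (m choose 2))"
    using choose2[of m] choose2[of "m + 3 * n"]
    by (simp add: algebra_simps power2_eq_square)
  then have exponent: "3 * n * (3 * n + 1) div 2 + m ^ 2 + 3 * m * n + m + 3 * n + 1 =
      1 + (2 * (m + 3 * n) + (m + 3 * n choose 2)) + (m choose 2)"
    by simp
  have "(qpoch X X m * qpoch (X ^ 3) (X ^ 3) n) $ 0 \<noteq> 0"
    by (simp add: fps_X_power_nth)
  then show ?thesis
    unfolding double_sum_term_def exponent
    by (simp add: exp_gf_def cub_gf_def fps_divide_unit fps_inverse_mult power_add mult_ac)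
qed

lemma has_sum_double_sum_term:
  "((\<lambda>(m, n). double_sum_term X m n) has_sum X * F_ser 2) UNIV"
proof -
  let ?f = "\<lambda>(m, n). double_sum_term X m n"
  have nth: "double_sum_term X m n $ p = 0" if "p < m + 3 * n" for m n p
    using that by (simp add: double_sum_term_eq fps_X_power_mult_nth mult.assoc)
  have "finite {mn \<in> UNIV. ?f mn $ p \<noteq> 0}" for p
  proof (rule finite_subset)
    show "{mn \<in> UNIV. ?f mn $ p \<noteq> 0} \<subseteq> {..p} \<times> {..p}"
    proof safe
      fix m n assume "double_sum_term X m n $ p \<noteq> 0"
      then have "m + 3 * n \<le> p"
        using nth by (meson not_le)
      then show "m \<le> p" "n \<le> p" by auto
    qed
  qed simp
  then have "?f summable_on UNIV"
    by (rule summable_on_fpsI)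
  then obtain S where S: "(?f has_sum S) UNIV"
    by (auto simp: summable_on_def)
  define D where "D = (\<lambda>k::nat. {(m, n). m + 3 * n = k})"
  \<comment> \<open>Tagging each pair with its value k = m + 3n presents the index set as a
    \<open>Sigma\<close> with finite fibres.\<close>
  have "((\<lambda>(k, mn). ?f mn) has_sum S) (Sigma UNIV D)"
    using S
    by (rule iffD2[OF has_sum_reindex_bij_witness[where i = "\<lambda>(m, n). (m + 3 * n, (m, n))" and j = snd],
          rotated -1]) (auto simp: D_def)
  moreover have "finite (D k)" for k
    by (rule finite_subset[of _ "{..k} \<times> {..k}"]) (auto simp: D_def)
  ultimately have "((\<lambda>k. \<Sum>mn\<in>D k. ?f mn) has_sum S) UNIV"
    by (auto dest: has_sum_finite_fibres)
  also have "(\<lambda>k. \<Sum>mn\<in>D k. ?f mn) = (\<lambda>k. X * F_term 2 k)"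
  proof
    fix k
    have "(\<Sum>mn\<in>D k. ?f mn) = (\<Sum>(m, n)\<in>D k. X * X ^ (2 * k + (k choose 2)) * (exp_gf $ m * cub_gf $ (3 * n)))"
      by (intro sum.cong) (auto simp: D_def double_sum_term_eq)
    also have "\<dots> = X * F_term 2 k"
      unfolding F_term_def gf_coeff_eq_sum D_def by (simp add: sum_distrib_left mult.assoc case_prod_unfold)
    finally show "(\<Sum>mn\<in>D k. ?f mn) = X * F_term 2 k" .
  qed
  finally have "((\<lambda>k. X * F_term 2 k) has_sum S) UNIV" .
  moreover have "((\<lambda>k. X * F_term 2 k) has_sum X * F_ser 2) UNIV"
    by (intro has_sum_cmult_right has_sum_F_ser) simp
  ultimately have "S = X * F_ser 2"
    by (rule has_sum_unique)
  with S show ?thesis by simp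
qed

subsection \<open>The continued fraction\<close>

text \<open>By \<open>F_ser_rec\<close> the ratios F(q^r) / F(q^(r+1)) obey the recursion of
  \<open>cf_denom\<close>. Stopping at \<open>M\<close> drops the tail q^(2M+1) F(q^(M+2)); each
  step down multiplies the error by a unit and a power of q, so it stays divisible by q^M.\<close>

lemma cf_denom_mult_F_ser:
  assumes "1 \<le> r" "r \<le> M"
  shows "X ^ M dvd cf_denom M r * F_ser (Suc r) - F_ser r"
  using assms(2,1)
proof (induction r rule: inc_induct)
  case base
  have "cf_denom M M * F_ser (Suc M) - F_ser M = X ^ M * (X ^ (M + 1) * F_ser (Suc (Suc M)))"
  proof -
    have "X ^ (2 * M + 1) = X ^ M * X ^ (M + 1)"
      unfolding power_add[symmetric] by (rule arg_cong[where f = "power X"]) simp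
    then show ?thesis
      using F_ser_rec[OF base] by (simp only: cf_denom_last) (simp add: algebra_simps)
  qed
  then show ?case by (metis dvd_triv_left)
next
  case (step r)
  define C where "C = cf_denom M (Suc r)"
  have C: "C $ 0 = 1"
    unfolding C_def using step.hyps by (intro cf_denom_nth_0) auto
  have "cf_denom M r = 1 + X ^ r - X ^ (2 * r + 1) * inverse C"
    using C step.hyps by (simp add: cf_denom_step fps_divide_unit flip: C_def)
  then have "cf_denom M r * F_ser (Suc r) - F_ser r =
      X ^ (2 * r + 1) * (F_ser (Suc (Suc r)) - inverse C * F_ser (Suc r))"
    by (simp only: F_ser_rec[OF step.prems]) (simp add: algebra_simps)
  also have "F_ser (Suc (Suc r)) - inverse C * F_ser (Suc r) =
      inverse C * (C * F_ser (Suc (Suc r)) - F_ser (Suc r))"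
    using inverse_mult_eq_1[of C] C by (simp add: right_diff_distrib flip: mult.assoc)
  finally show ?case
    using step.IH step.prems by (simp add: C_def dvd_mult)
qed

lemma cf_tendsto: "(\<lambda>M. X / cf_denom M 1) \<longlonglongrightarrow> X * F_ser 2 * inverse (F_ser 1)"
proof -
  have F0: "F_ser 1 $ 0 = 1" "F_ser 2 $ 0 = 1"
    using F_ser_nth[of 1 0] F_ser_nth[of 2 0] by auto
  have "(\<lambda>M. cf_denom M 1 * F_ser 2) \<longlonglongrightarrow> F_ser 1"
  proof (rule tendsto_fpsI)
    fix n
    show "\<forall>\<^sub>F M in sequentially. (cf_denom M 1 * F_ser 2) $ n = F_ser 1 $ n"
      using eventually_gt_at_top[of n]
    proof eventually_elim
      case (elim M)
      then have "(cf_denom M 1 * F_ser (Suc 1) - F_ser 1) $ n = 0"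
        by (intro fps_X_power_dvd_nth[OF cf_denom_mult_F_ser]) auto
      then show ?case by (simp add: numeral_2_eq_2)
    qed
  qed
  \<comment> \<open>Inversion is continuous at a series with nonzero constant term such as
    \<open>F_ser 1\<close>. The auxiliary factor \<open>F_ser 2\<close> is a unit and cancels once M
    >= 1.\<close>
  then have "(\<lambda>M. X * F_ser 2 * inverse (cf_denom M 1 * F_ser 2)) \<longlonglongrightarrow> X * F_ser 2 * inverse (F_ser 1)"
    using F0 by (intro tendsto_mult tendsto_const tendsto_inverse_fps) auto
  moreover have "\<forall>\<^sub>F M in sequentially. X * F_ser 2 * inverse (cf_denom M 1 * F_ser 2) = X / cf_denom M 1"
    using eventually_ge_at_top[of 1]
  proof eventually_elim
    case (elim M)
    then have "cf_denom M 1 $ 0 = 1"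
      by (intro cf_denom_nth_0) auto
    moreover have "F_ser 2 * inverse (F_ser 2) = 1"
      using F0 by (intro inverse_mult_eq_1') simp
    ultimately show ?case
      by (simp add: fps_divide_unit fps_inverse_mult mult_ac)
  qed
  ultimately show ?thesis
    by (rule Lim_transform_eventually)
qed

subsection \<open>Evaluation of $F(q)$\<close>

text \<open>This is the reciprocal of the product of 1 + q^j + q^(2j) over 1 <= j <= n. Up to the
  constant (q^3;q^3)_inf / (q;q)_inf it is the product over all j > n.\<close>

definition qpoch_ratio :: "nat \<Rightarrow> rat fps" where
  "qpoch_ratio n = qpoch X X n * inverse (qpoch (X ^ 3) (X ^ 3) n)"

definition T_coeff :: "nat \<Rightarrow> rat fps" where
  "T_coeff k = (- 1) ^ k * X ^ (3 * (k choose 2)) * inverse (qpoch X X k)"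

text \<open>From 1 - y^3 = (1 - y)(1 + y + y^2) at y = q^(n+1). This direction lets all terms be
  written with the ratio of largest index.\<close>

lemma qpoch_ratio_Suc: "qpoch_ratio n = qpoch_ratio (Suc n) * (1 + X ^ Suc n + X ^ (2 * Suc n))"
proof -
  define i where "i = inverse (qpoch (X ^ 3) (X ^ 3) (Suc n))"
  have i: "inverse (qpoch (X ^ 3) (X ^ 3) n) = i * (1 - X ^ 3 * (X ^ 3) ^ n)"
    unfolding i_def by (rule inverse_qpoch_Suc[symmetric]) simp
  define y where "y = X ^ Suc n"
  have y: "X * X ^ n = y" "X ^ 3 * (X ^ 3) ^ n = y ^ 3" "X ^ (2 * Suc n) = y ^ 2"
    unfolding y_def power_Suc[symmetric] power_mult[symmetric] power_add[symmetric]
    by (rule arg_cong[where f = "power X"]; simp)+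
  show ?thesis
    unfolding qpoch_ratio_def i i_def[symmetric] unfolding qpoch_Suc y y_def[symmetric]
    by (simp add: algebra_simps power2_eq_square power3_eq_cube)
qed

text \<open>A factor 1 - q^(k+1) is what allows the summation index to be lowered by one.\<close>

lemma T_coeff_Suc: "T_coeff (Suc k) * (1 - X ^ Suc k) = - (X ^ (3 * k) * T_coeff k)"
proof -
  define i where "i = inverse (qpoch X X (Suc k))"
  have "i * (1 - X * X ^ k) = inverse (qpoch X X k)"
    unfolding i_def by (rule inverse_qpoch_Suc) simp
  then have "inverse (qpoch X X k) = i * (1 - X ^ Suc k)"
    by simp
  then show ?thesis
    unfolding T_coeff_def i_def[symmetric] Suc_choose_2 distrib_left power_add by (simp add: mult_ac)
qed

text \<open>
  Note the shift: \<open>T_ser r\<close> is the transformed series at $x = q^{r+1}$, without its constant factor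
  $(q^3;q^3)_\infty / (q;q)_\infty$.
\<close>

definition T_term :: "nat \<Rightarrow> nat \<Rightarrow> rat fps" where
  "T_term r k = X ^ (2 * Suc r * k) * (T_coeff k * qpoch_ratio (k + r))"

definition T_ser :: "nat \<Rightarrow> rat fps" where
  "T_ser r = (\<Sum>\<^sub>\<infinity>k. T_term r k)"

lemma has_sum_X_power_mult:
  fixes f :: "nat \<Rightarrow> rat fps"
  shows "((\<lambda>k. X ^ (2 * Suc r * k) * f k) has_sum (\<Sum>\<^sub>\<infinity>k. X ^ (2 * Suc r * k) * f k)) UNIV"
proof (intro has_sum_infsum summable_on_fpsI)
  fix n
  show "finite {k \<in> UNIV. (X ^ (2 * Suc r * k) * f k) $ n \<noteq> 0}"
  proof (rule finite_subset)
    show "{k \<in> UNIV. (X ^ (2 * Suc r * k) * f k) $ n \<noteq> 0} \<subseteq> {..n}"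
      by (auto simp: fps_X_power_mult_nth split: if_splits)
  qed simp
qed

lemma has_sum_T_ser: "(T_term r has_sum T_ser r) UNIV"
  unfolding T_ser_def T_term_def by (rule has_sum_X_power_mult)

text \<open>Terms with k >= 1 are divisible by q^(2r+2), and the term k = 0 is
  \<open>qpoch_ratio r\<close>.\<close>

lemma T_ser_nth:
  assumes "n \<le> r"
  shows "T_ser r $ n = qpoch_ratio r $ n"
proof -
  have "T_ser r $ n = (\<Sum>k\<in>{0}. T_term r k $ n)"
  proof (rule has_sum_fps_nth_eq[OF has_sum_T_ser])
    fix k assume "k \<in> UNIV - {0::nat}"
    then have "2 * Suc r * 1 \<le> 2 * Suc r * k"
      by (intro mult_le_mono2) auto
    moreover have "n < 2 * Suc r * 1"
      using assms by simp
    ultimately have "n < 2 * Suc r * k"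
      by (rule order.strict_trans2[rotated])
    then show "T_term r k $ n = 0"
      unfolding T_term_def by (simp only: fps_X_power_mult_nth if_True)
  qed auto
  then show ?thesis by (simp add: T_term_def T_coeff_def numeral_2_eq_2)
qed

text \<open>
  \<open>U_ser r\<close> is the defect in the recurrence for \<open>T_ser\<close>. It does not telescope, but it reproduces
  itself with a factor $x^2$ under $x \mapsto xq$, which forces it to vanish.
\<close>

definition U_term :: "nat \<Rightarrow> nat \<Rightarrow> rat fps" where
  "U_term r k = X ^ (2 * Suc r * k) * (T_coeff k * qpoch_ratio (Suc (k + r)) *
     ((1 - X ^ k) * (1 + X ^ Suc (k + r)) + (X ^ Suc (k + r)) ^ 2))"

definition U_ser :: "nat \<Rightarrow> rat fps" where
  "U_ser r = (\<Sum>\<^sub>\<infinity>k. U_term r k)"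

lemma has_sum_U_ser: "(U_term r has_sum U_ser r) UNIV"
  unfolding U_ser_def U_term_def by (rule has_sum_X_power_mult)

text \<open>The part \<open>v\<close> of the summand has the factor 1 - q^k, so it vanishes at k = 0
  and can be shifted by \<open>T_coeff_Suc\<close>. Added to the unshifted part \<open>w\<close>, it
  rebuilds the summand at xq.\<close>

lemma U_ser_Suc: "U_ser r = X ^ (2 * Suc r) * U_ser (Suc r)"
proof -
  define v where "v k = X ^ (2 * Suc r * k) * (T_coeff k * qpoch_ratio (Suc (k + r)) *
     ((1 - X ^ k) * (1 + X ^ Suc (k + r))))" for k
  define w where "w k = X ^ (2 * Suc r * k) * (T_coeff k * qpoch_ratio (Suc (k + r)) * (X ^ Suc (k + r)) ^ 2)" for k
  obtain V W where V: "(v has_sum V) UNIV" and W: "(w has_sum W) UNIV"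
    unfolding v_def w_def using has_sum_X_power_mult by meson
  have "((\<lambda>k. v k + w k) has_sum (V + W)) UNIV"
    using V W by (rule has_sum_add)
  moreover have "(\<lambda>k. v k + w k) = U_term r"
    by (auto simp: v_def w_def U_term_def distrib_left)
  ultimately have "U_ser r = V + W"
    using has_sum_U_ser has_sum_unique by metis
  have "v 0 = 0"
    by (simp add: v_def)
  then have "((\<lambda>k. v (Suc k)) has_sum V) UNIV"
    using V has_sum_Suc_iff by blast
  then have "((\<lambda>k. v (Suc k) + w k) has_sum (V + W)) UNIV"
    using W by (rule has_sum_add)
  also have "(\<lambda>k. v (Suc k) + w k) = (\<lambda>k. X ^ (2 * Suc r) * U_term (Suc r) k)"
  proof
    fix k
    \<comment> \<open>Up to the factor Z x^2 y^2 g and \<open>T_coeff k\<close>, the claim is the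
      identity -y (1 + p) + (1 + p + p^2) = (1 - y)(1 + p) + p^2.\<close>
    define y p x Z g where "y = X ^ k" and "p = X ^ Suc (Suc (k + r))" and "x = X ^ Suc r"
      and "Z = X ^ (2 * Suc r * k)" and "g = qpoch_ratio (Suc (Suc (k + r)))"
    have exps: "X ^ (2 * Suc r * Suc k) = Z * x ^ 2" "X ^ (2 * Suc (Suc r) * k) = Z * y ^ 2"
      "X ^ Suc (k + r) = x * y" "X ^ (3 * k) = y ^ 3" "X ^ (2 * Suc r) = x ^ 2"
      unfolding Z_def x_def y_def power_mult[symmetric] power_add[symmetric]
      by (rule arg_cong[where f = "power X"]; simp)+
    have ratio: "qpoch_ratio (Suc (k + r)) = g * (1 + p + p ^ 2)"
      unfolding g_def p_def by (subst qpoch_ratio_Suc) (simp only: power_mult[symmetric] mult.commute)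
    have coeff: "T_coeff (Suc k) * (1 - X ^ Suc k) = - (y ^ 3 * T_coeff k)"
      using T_coeff_Suc[of k] by (simp only: exps)
    have "v (Suc k) = Z * x ^ 2 * ((T_coeff (Suc k) * (1 - X ^ Suc k)) * g * (1 + p))"
      unfolding v_def exps g_def p_def by (simp only: add_Suc mult_ac)
    also have "\<dots> = Z * x ^ 2 * (- (y ^ 3 * T_coeff k) * g * (1 + p))"
      unfolding coeff ..
    finally have 1: "v (Suc k) = Z * x ^ 2 * (- (y ^ 3 * T_coeff k) * g * (1 + p))" .
    have 2: "w k = Z * (T_coeff k * (g * (1 + p + p ^ 2)) * (x * y) ^ 2)"
      unfolding w_def ratio exps Z_def ..
    have 3: "U_term (Suc r) k = Z * y ^ 2 * (T_coeff k * g * ((1 - y) * (1 + p) + p ^ 2))"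
      unfolding U_term_def exps g_def p_def y_def by simp
    show "v (Suc k) + w k = X ^ (2 * Suc r) * U_term (Suc r) k"
      unfolding 1 2 3 exps by (simp add: algebra_simps power2_eq_square power3_eq_cube)
  qed
  finally have "((\<lambda>k. X ^ (2 * Suc r) * U_term (Suc r) k) has_sum U_ser r) UNIV"
    unfolding \<open>U_ser r = V + W\<close> .
  moreover have "((\<lambda>k. X ^ (2 * Suc r) * U_term (Suc r) k) has_sum X ^ (2 * Suc r) * U_ser (Suc r)) UNIV"
    by (intro has_sum_cmult_right has_sum_U_ser)
  ultimately show ?thesis
    by (rule has_sum_unique)
qed

text \<open>Coefficient \<open>n\<close> of \<open>U_ser r\<close> is zero or a strictly lower
  coefficient of \<open>U_ser (Suc r)\<close>; hence strong induction for all \<open>r\<close> at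
  once.\<close>

lemma U_ser_eq_0: "U_ser r = 0"
proof -
  have "\<forall>r. U_ser r $ n = 0" for n
  proof (induction n rule: less_induct)
    case (less n)
    show ?case
    proof
      fix r
      show "U_ser r $ n = 0"
        unfolding U_ser_Suc[of r] fps_X_power_mult_nth using less.IH by simp
    qed
  qed
  then show ?thesis by (simp add: fps_eq_iff)
qed

text \<open>Once the last series is delayed by one index, the defect of the recurrence is termwise
  \<open>U_term r\<close>, whose sum vanishes.\<close>

lemma T_ser_rec: "T_ser r = (1 + X ^ Suc r) * T_ser (Suc r) - X ^ (2 * Suc r + 1) * T_ser (Suc (Suc r))"
proof -
  define e where "e k = (if k = 0 then 0 else X ^ (2 * Suc r + 1) * T_term (Suc (Suc r)) (k - 1))" for k
  have "((\<lambda>k. e (Suc k)) has_sum X ^ (2 * Suc r + 1) * T_ser (Suc (Suc r))) UNIV"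
    unfolding e_def by (simp, intro has_sum_cmult_right has_sum_T_ser)
  then have "(e has_sum X ^ (2 * Suc r + 1) * T_ser (Suc (Suc r))) UNIV"
    by (subst (asm) has_sum_Suc_iff) (simp_all add: e_def)
  then have "((\<lambda>k. T_term r k - (1 + X ^ Suc r) * T_term (Suc r) k + e k) has_sum
      (T_ser r - (1 + X ^ Suc r) * T_ser (Suc r) + X ^ (2 * Suc r + 1) * T_ser (Suc (Suc r)))) UNIV"
    by (intro has_sum_add has_sum_diff has_sum_cmult_right has_sum_T_ser)
  also have "(\<lambda>k. T_term r k - (1 + X ^ Suc r) * T_term (Suc r) k + e k) = U_term r"
  proof
    fix k
    define y p x Z g where "y = X ^ k" and "p = X ^ Suc (k + r)" and "x = X ^ Suc r"
      and "Z = X ^ (2 * Suc r * k)" and "g = qpoch_ratio (Suc (k + r))"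
    have exps: "X ^ (2 * Suc (Suc r) * k) = Z * y ^ 2" "p = x * y"
      unfolding Z_def x_def y_def p_def power_mult[symmetric] power_add[symmetric]
      by (rule arg_cong[where f = "power X"]; simp)+
    have ratio: "qpoch_ratio (k + r) = g * (1 + p + p ^ 2)"
      unfolding g_def p_def by (subst qpoch_ratio_Suc) (simp only: power_mult[symmetric] mult.commute)
    have 1: "T_term r k = Z * (T_coeff k * (g * (1 + p + p ^ 2)))"
      unfolding T_term_def ratio Z_def ..
    have 2: "T_term (Suc r) k = Z * y ^ 2 * T_coeff k * g"
      unfolding T_term_def exps g_def by simp
    have 3: "U_term r k = Z * (T_coeff k * g * ((1 - y) * (1 + p) + p ^ 2))"
      unfolding U_term_def Z_def g_def y_def p_def ..
    \<comment> \<open>\<open>T_coeff_Suc\<close> trades the delayed coefficient for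
      \<open>T_coeff k * (1 - y)\<close>; at \<open>k = 0\<close> both sides vanish.\<close>
    have 4: "e k = - (T_coeff k * (1 - y) * (Z * y * g))"
    proof (cases k)
      case 0
      then show ?thesis by (simp add: e_def y_def)
    next
      case (Suc j)
      have "T_coeff k * (1 - y) = - (X ^ (3 * j) * T_coeff j)"
        unfolding Suc y_def by (rule T_coeff_Suc)
      moreover have "X ^ (2 * Suc r + 1) * X ^ (2 * Suc (Suc (Suc r)) * j) = X ^ (3 * j) * Z * y"
        unfolding Z_def y_def Suc power_add[symmetric]
        by (rule arg_cong[where f = "power X"]) simp
      moreover have "e k = (X ^ (2 * Suc r + 1) * X ^ (2 * Suc (Suc (Suc r)) * j)) * T_coeff j * g"
        unfolding e_def T_term_def g_def Suc by (simp add: mult.assoc)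
      ultimately show ?thesis by (simp add: mult_ac)
    qed
    show "T_term r k - (1 + X ^ Suc r) * T_term (Suc r) k + e k = U_term r k"
      unfolding 1 2 3 4 x_def[symmetric] exps
      by (simp add: algebra_simps power2_eq_square)
  qed
  finally have "T_ser r - (1 + X ^ Suc r) * T_ser (Suc r) + X ^ (2 * Suc r + 1) * T_ser (Suc (Suc r)) = U_ser r"
    using has_sum_U_ser has_sum_unique by blast
  then show ?thesis
    by (simp add: U_ser_eq_0 algebra_simps)
qed

text \<open>For r = 0 the (q;q)_k in \<open>T_coeff k\<close> and \<open>qpoch_ratio k\<close>
  cancel, leaving \<open>has_sum_qpoch_inf\<close> with \<open>a = 2\<close> and
  \<open>b = 3\<close>.\<close>

lemma T_ser_0: "T_ser 0 = qpoch_inf (X ^ 2) (X ^ 3)"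
proof -
  have "(\<lambda>k. (- 1) ^ k * (X ^ 2) ^ k * (X ^ 3) ^ (k choose 2) * inverse (qpoch (X ^ 3) (X ^ 3) k)) = T_term 0"
  proof
    fix k
    have "inverse (qpoch X X k) * qpoch X X k = 1"
      by (intro inverse_mult_eq_1) simp
    then have "T_coeff k * qpoch_ratio k = (- 1) ^ k * X ^ (3 * (k choose 2)) * inverse (qpoch (X ^ 3) (X ^ 3) k)"
      by (simp add: T_coeff_def qpoch_ratio_def mult_ac)
    then show "(- 1) ^ k * (X ^ 2) ^ k * (X ^ 3) ^ (k choose 2) * inverse (qpoch (X ^ 3) (X ^ 3) k) = T_term 0 k"
      unfolding T_term_def power_mult[symmetric] by (simp add: mult_ac)
  qed
  then have "(T_term 0 has_sum qpoch_inf (X ^ 2) (X ^ 3)) UNIV"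
    using has_sum_qpoch_inf[of 2 3] by simp
  with has_sum_T_ser show ?thesis
    by (rule has_sum_unique)
qed

section \<open>Comparison of both series and the value of F(q)\<close>

lemma qpoch_ratio_tendsto: "qpoch_ratio \<longlonglongrightarrow> qpoch_inf X X * inverse (qpoch_inf (X ^ 3) (X ^ 3))"
proof -
  have "qpoch X X \<longlonglongrightarrow> qpoch_inf X X"
    using qpoch_tendsto_inf[of 1 1, where 'a = rat] unfolding power_one_right by simp
  then show ?thesis
    unfolding qpoch_ratio_def
    by (intro tendsto_mult tendsto_inverse_fps qpoch_tendsto_inf) (simp_all add: qpoch_inf_nth_0)
qed

text \<open>D(r) - D(r+1) is q^(r+1) times a combination of D(r+1) and D(r+2). If all lower
  coefficients vanish, coefficient \<open>n\<close> is thus the same for every \<open>r\<close>, and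
  the limit makes it 0.\<close>

lemma three_term_unique:
  assumes rec: "\<And>r. D r = (1 + X ^ Suc r) * D (Suc r) - X ^ (2 * Suc r + 1) * D (Suc (Suc r))"
    and lim: "D \<longlonglongrightarrow> 0"
  shows "D r = 0"
proof -
  have "\<forall>r. D r $ n = 0" for n
  proof (induction n rule: less_induct)
    case (less n)
    have step: "D r $ n = D (Suc r) $ n" for r
    proof -
      have "X ^ (2 * Suc r + 1) = X ^ Suc r * X ^ Suc (Suc r)"
        unfolding power_add[symmetric] by (rule arg_cong[where f = "power X"]) simp
      then have "D r - D (Suc r) = X ^ Suc r * (D (Suc r) - X ^ Suc (Suc r) * D (Suc (Suc r)))"
        by (simp only: rec[of r]) (simp add: algebra_simps)
      then have "(D r - D (Suc r)) $ n = 0"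
        using less.IH by (simp only: fps_X_power_mult_nth fps_sub_nth) simp
      then show ?thesis by simp
    qed
    show ?case
    proof
      fix r
      have "\<forall>\<^sub>F m in sequentially. D m $ n = 0"
        using lim unfolding tendsto_fps_iff by simp
      then obtain m where "m \<ge> r" "D m $ n = 0"
        unfolding eventually_sequentially by (meson nle_le)
      moreover from \<open>m \<ge> r\<close> have "D r $ n = D m $ n"
        by (induction m rule: dec_induct) (simp_all flip: step)
      ultimately show "D r $ n = 0" by simp
    qed
  qed
  then show ?thesis by (simp add: fps_eq_iff)
qed

text \<open>Both sides solve the same recurrence and tend to the constant \<open>K\<close>, since
  F(q^(r+1)) tends to 1 and \<open>T_ser r\<close> follows \<open>qpoch_ratio r\<close>.\<close>

lemma F_ser_eq_T_ser: "F_ser (Suc r) * (qpoch_inf X X * inverse (qpoch_inf (X ^ 3) (X ^ 3))) = T_ser r"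
proof -
  define K where "K = qpoch_inf X X * inverse (qpoch_inf (X ^ 3) (X ^ 3))"
  define D where "D r = F_ser (Suc r) * K - T_ser r" for r
  have "D r = 0"
  proof (rule three_term_unique)
    fix r
    show "D r = (1 + X ^ Suc r) * D (Suc r) - X ^ (2 * Suc r + 1) * D (Suc (Suc r))"
    proof -
      define y Z where "y = X ^ Suc r" and "Z = X ^ (2 * Suc r + 1)"
      have rec: "F_ser (Suc r) = (1 + y) * F_ser (Suc (Suc r)) - Z * F_ser (Suc (Suc (Suc r)))"
        unfolding y_def Z_def by (rule F_ser_rec) simp
      show ?thesis
        unfolding D_def rec T_ser_rec[of r] y_def[symmetric] Z_def[symmetric]
        by (simp add: algebra_simps)
    qed
  next
    have "(\<lambda>r. F_ser (Suc r)) \<longlonglongrightarrow> 1"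
    proof (rule tendsto_fpsI)
      fix n
      show "\<forall>\<^sub>F r in sequentially. F_ser (Suc r) $ n = 1 $ n"
        using eventually_ge_at_top[of n] by eventually_elim (intro F_ser_nth; simp)
    qed
    moreover have "T_ser \<longlonglongrightarrow> K"
    proof (rule tendsto_fpsI)
      fix n
      have "\<forall>\<^sub>F r in sequentially. qpoch_ratio r $ n = K $ n"
        using qpoch_ratio_tendsto unfolding tendsto_fps_iff K_def by blast
      then show "\<forall>\<^sub>F r in sequentially. T_ser r $ n = K $ n"
        using eventually_ge_at_top[of n] by eventually_elim (simp add: T_ser_nth)
    qed
    ultimately have "(\<lambda>r. F_ser (Suc r) * K - T_ser r) \<longlonglongrightarrow> 1 * K - K"
      by (intro tendsto_diff tendsto_mult tendsto_const)
    moreover have "D = (\<lambda>r. F_ser (Suc r) * K - T_ser r)"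
      by (rule ext) (rule D_def)
    ultimately show "D \<longlonglongrightarrow> 0"
      by simp
  qed
  then show ?thesis by (simp add: D_def K_def)
qed

text \<open>Sorts the factors by exponent modulo 3, first in the finite products of length 3n and
  then in the limit.\<close>

lemma qpoch_inf_trisect:
  "qpoch_inf X X = qpoch_inf X (X ^ 3) * qpoch_inf (X ^ 2) (X ^ 3) * qpoch_inf (X ^ 3) (X ^ 3)"
proof -
  have *: "qpoch X X (3 * n) = qpoch X (X ^ 3) n * qpoch (X ^ 2) (X ^ 3) n * qpoch (X ^ 3) (X ^ 3) n" for n
  proof (induction n)
    case (Suc n)
    have "3 * Suc n = Suc (Suc (Suc (3 * n)))"
      by simp
    moreover have "X * X ^ (3 * n) = X * (X ^ 3) ^ n" "X * X ^ Suc (3 * n) = X ^ 2 * (X ^ 3) ^ n"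
      "X * X ^ Suc (Suc (3 * n)) = X ^ 3 * (X ^ 3) ^ n"
      by (simp_all add: power_mult power2_eq_square power3_eq_cube mult.assoc)
    ultimately have "qpoch X X (3 * Suc n) = qpoch X X (3 * n) *
        (1 - X * (X ^ 3) ^ n) * (1 - X ^ 2 * (X ^ 3) ^ n) * (1 - X ^ 3 * (X ^ 3) ^ n)"
      by (simp only: qpoch_Suc)
    then show ?case
      by (simp only: Suc.IH) (simp only: qpoch_Suc mult_ac)
  qed simp
  have "qpoch X X \<longlonglongrightarrow> qpoch_inf X X"
    using qpoch_tendsto_inf[of 1 1, where 'a = rat] unfolding power_one_right by simp
  then have 1: "(\<lambda>n. qpoch X X (3 * n)) \<longlonglongrightarrow> qpoch_inf X X"
    by (rule filterlim_compose) (rule mult_nat_left_at_top, simp)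
  have "qpoch X (X ^ 3) \<longlonglongrightarrow> qpoch_inf X (X ^ 3)"
    using qpoch_tendsto_inf[of 1 3, where 'a = rat] unfolding power_one_right by simp
  then have "(\<lambda>n. qpoch X X (3 * n)) \<longlonglongrightarrow>
      qpoch_inf X (X ^ 3) * qpoch_inf (X ^ 2) (X ^ 3) * qpoch_inf (X ^ 3) (X ^ 3)"
    unfolding * by (intro tendsto_mult qpoch_tendsto_inf) simp_all
  with 1 show ?thesis
    by (rule LIMSEQ_unique)
qed

text \<open>Trisection turns the case r = 0 of \<open>F_ser_eq_T_ser\<close> into F(q) P1 P2 = P2,
  and P2 is nonzero.\<close>

lemma F_ser_1: "F_ser 1 * qpoch_inf X (X ^ 3) = 1"
proof -
  define P1 P2 P3 where "P1 = qpoch_inf X (X ^ 3)" and "P2 = qpoch_inf (X ^ 2) (X ^ 3)"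
    and "P3 = qpoch_inf (X ^ 3) (X ^ 3)"
  have nth: "P2 $ 0 = 1" "P3 $ 0 = 1"
    unfolding P2_def P3_def by (intro qpoch_inf_nth_0; simp)+
  have "P3 * inverse P3 = 1"
    using nth by (intro inverse_mult_eq_1') simp
  have "P2 = F_ser 1 * (P1 * P2 * P3 * inverse P3)"
    using F_ser_eq_T_ser[of 0] by (simp add: T_ser_0 qpoch_inf_trisect P1_def P2_def P3_def)
  also have "\<dots> = F_ser 1 * P1 * P2 * (P3 * inverse P3)"
    by (simp only: mult.assoc)
  finally have "1 * P2 = F_ser 1 * P1 * P2"
    using \<open>P3 * inverse P3 = 1\<close> by simp
  moreover have "P2 \<noteq> 0"
    using nth by auto
  ultimately show ?thesis
    unfolding P1_def by (metis mult_right_cancel)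
qed

text \<open>The first two conjuncts certify that the product and the double sum in the third are
  genuine limits rather than default values.\<close>

theorem theorem6p3:
  fixes q :: "rat fps"
  assumes "q = fps_X"
  shows "convergent_prod (\<lambda>j. 1 - q * (q ^ 3) ^ j) \<and>
         (\<lambda>(m, n). double_sum_term q m n) summable_on UNIV \<and>
         (\<lambda>M. q / cf_denom M 1) \<longlonglongrightarrow>
           qpoch_inf q (q ^ 3) * (\<Sum>\<^sub>\<infinity>(m, n)\<in>UNIV. double_sum_term q m n)"
proof (intro conjI)
  show "convergent_prod (\<lambda>j. 1 - q * (q ^ 3) ^ j)"
    using convergent_prod_qpoch[of 1 3, where 'a = rat] by (simp add: assms)
  show "(\<lambda>(m, n). double_sum_term q m n) summable_on UNIV"
    unfolding assms using has_sum_double_sum_term by (rule has_sum_imp_summable)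
  have "inverse (F_ser 1) = qpoch_inf X (X ^ 3)"
    using F_ser_1 by (rule fps_inverse_unique)
  then show "(\<lambda>M. q / cf_denom M 1) \<longlonglongrightarrow>
      qpoch_inf q (q ^ 3) * (\<Sum>\<^sub>\<infinity>(m, n)\<in>UNIV. double_sum_term q m n)"
    unfolding assms using cf_tendsto by (simp only: infsumI[OF has_sum_double_sum_term] mult.commute)
qed

end
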